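(* Let $n\in\mathbb P$, let $\mathbf a\in\mathbb{P}^n$ and let $(\Delta,\pi)$ be a pure $\mathbf a$-balanced complex. If $(\Delta,\pi)$ is color-shifted, then $\Delta$ is $\mathbf a$-Macaulay decomposable.
   Context: $\mathbb N=\{0,1,\dots\}$, $\mathbb P=\{1,2,\dots\}$, $[n]=\{1,\dots,n\}$; for $\mathbf x,\mathbf y\in\mathbb Z^n$, $\mathbf x\le\mathbf y$ is componentwise, $\mathbf x<\mathbf y$ means $\mathbf x\le\mathbf y$ and $\mathbf x\neq\mathbf y$, and $|\mathbf x|=x_1+\dots+x_n$. A simplicial complex $\Delta$ on a finite vertex set $V$ is a collection of subsets of $V$ (faces) closed under taking subsets with $\{v\}\in\Delta$ for all $v\in V$; facets are maximal faces; $\dim F=|F|-1$; $\Delta$ is pure if all facets have the same dimension. $\langle\mathcal F\rangle$ denotes the smallest simplicial complex containing all sets of a family $\mathcal F$. A simplex is a complex generated by one face. For a vertex $x$, $\mathrm{dl}_\Delta(x)=\{\tau\in\Delta:x\notin\tau\}$ and $\mathrm{lk}_\Delta(x)=\{\tau\in\Delta:x\notin\tau,\ \tau\cup\{x\}\in\Delta\}$. The complex $\{\emptyset\}$ is allowed as a link or deletion. An $\mathbf a$-colored complex, $\mathbf a\in\mathbb P^n$, is a pair $(\Delta,\pi)$ with $\pi=(V_1,\dots,V_n)$ an ordered partition of $V$ into non-empty sets such that $|F\cap V_i|\le a_i$ for every face $F$ and every $i$; it is $\mathbf a$-balanced if moreover $\dim\Delta=|\mathbf a|-1$. With each $V_i$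 linearly ordered, $(\Delta,\pi)$ is color-shifted if for every face $F$, every $i\in[n]$, and all $v'<v$ in $V_i$ with $v\in F$, $v'\notin F$, one has $(F\setminus\{v\})\cup\{v'\}\in\Delta$. For $\mathbf a\in\mathbb N^n$, an $\mathbf a$-rib of a complex $\Delta$ on $V$ is a subcomplex of the form $\langle\{F_1\cup\dots\cup F_n\in\Delta: F_i\subseteq V_i,\ |F_i|=a_i\text{ for each }i\}\rangle$ for some ordered partition $(V_1,\dots,V_n)$ of $V$ into non-empty sets (with the generating family non-empty, so a rib is pure of dimension $|\mathbf a|-1$). A simplicial complex $\Delta$ on $V$ is $\mathbf a$-Macaulay decomposable if (i) $\Delta$ is an $\mathbf a$-rib of a simplex; or (ii) there exist $x\in V$ (a Macaulay shedding vertex of $\Delta$) and $\mathbf a'\in\mathbb N^n$ with $\mathbf a'<\mathbf a$ such that $\mathrm{dl}_\Delta(x)$ is $\mathbf a$-Macaulay decomposable, $\mathrm{lk}_\Delta(x)$ is $\mathbf a'$-Macaulay decomposable, and no facet of $\mathrm{lk}_\Delta(x)$ is a facet of $\mathrm{dl}_\Delta(x)$. *)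

theory Defs
  imports Main "HOL-Library.Disjoint_Sets"
begin

text \<open>
  A complex is represented by its set of faces alone. Since every element of the vertex set
  is required to span a face, the vertex set is recovered as the union of all faces.
\<close>

definition vertices :: "'a set set \<Rightarrow> 'a set" where
  "vertices \<Delta> = \<Union>\<Delta>"

definition simplicial_complex :: "'a set set \<Rightarrow> bool" where
  "simplicial_complex \<Delta> \<longleftrightarrow>
     finite (vertices \<Delta>) \<and> (\<forall>F\<in>\<Delta>. \<forall>G. G \<subseteq> F \<longrightarrow> G \<in> \<Delta>)"

definition facet :: "'a set \<Rightarrow> 'a set set \<Rightarrow> bool" where
  "facet F \<Delta> \<longleftrightarrow> F \<in> \<Delta> \<and> (\<forall>G\<in>\<Delta>. F \<subseteq> G \<longrightarrow> G = F)"

definition face_dim :: "'a set \<Rightarrow> int" where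
  "face_dim F = int (card F) - 1"

text \<open>Only meaningful for non-empty complexes; the dimension of \<open>{{}}\<close> is \<open>-1\<close>.\<close>

definition complex_dim :: "'a set set \<Rightarrow> int" where
  "complex_dim \<Delta> = Max (face_dim ` \<Delta>)"

definition pure_complex :: "'a set set \<Rightarrow> bool" where
  "pure_complex \<Delta> \<longleftrightarrow> (\<forall>F G. facet F \<Delta> \<longrightarrow> facet G \<Delta> \<longrightarrow> face_dim F = face_dim G)"

definition generated_complex :: "'a set set \<Rightarrow> 'a set set" where
  "generated_complex \<F> = \<Inter>{\<Gamma>. simplicial_complex \<Gamma> \<and> \<F> \<subseteq> \<Gamma>}"

lemma generated_complex_eq:
  assumes "finite (\<Union>\<F>)"
  shows "generated_complex \<F> = {G. \<exists>F\<in>\<F>. G \<subseteq> F}"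
proof
  have "\<Union>{G. \<exists>F\<in>\<F>. G \<subseteq> F} \<subseteq> \<Union>\<F>"
    by blast
  then have "simplicial_complex {G. \<exists>F\<in>\<F>. G \<subseteq> F}"
    using assms unfolding simplicial_complex_def vertices_def
    by (blast intro: finite_subset order_trans)
  then show "generated_complex \<F> \<subseteq> {G. \<exists>F\<in>\<F>. G \<subseteq> F}"
    unfolding generated_complex_def by blast
  show "{G. \<exists>F\<in>\<F>. G \<subseteq> F} \<subseteq> generated_complex \<F>"
    unfolding generated_complex_def simplicial_complex_def by blast
qed

definition simplex :: "'a set set \<Rightarrow> bool" where
  "simplex \<Delta> \<longleftrightarrow> (\<exists>W. finite W \<and> \<Delta> = generated_complex {W})"

definition deletion :: "'a set set \<Rightarrow> 'a \<Rightarrow> 'a set set" where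
  "deletion \<Delta> x = {\<tau>\<in>\<Delta>. x \<notin> \<tau>}"

definition link :: "'a set set \<Rightarrow> 'a \<Rightarrow> 'a set set" where
  "link \<Delta> x = {\<tau>\<in>\<Delta>. x \<notin> \<tau> \<and> \<tau> \<union> {x} \<in> \<Delta>}"

text \<open>
  Vectors with \<open>n\<close> entries and ordered partitions into \<open>n\<close> parts are functions on \<open>nat\<close>
  of which only the values at \<open>1, \<dots>, n\<close> matter.
\<close>

definition ordered_partition :: "nat \<Rightarrow> (nat \<Rightarrow> 'a set) \<Rightarrow> 'a set \<Rightarrow> bool" where
  "ordered_partition n V A \<longleftrightarrow>
     (\<forall>i\<in>{1..n}. V i \<noteq> {}) \<and> disjoint_family_on V {1..n} \<and> (\<Union>i\<in>{1..n}. V i) = A"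

definition vec_less :: "nat \<Rightarrow> (nat \<Rightarrow> nat) \<Rightarrow> (nat \<Rightarrow> nat) \<Rightarrow> bool" where
  "vec_less n x y \<longleftrightarrow> (\<forall>i\<in>{1..n}. x i \<le> y i) \<and> (\<exists>i\<in>{1..n}. x i \<noteq> y i)"

definition colored_complex ::
  "nat \<Rightarrow> (nat \<Rightarrow> nat) \<Rightarrow> 'a set set \<Rightarrow> (nat \<Rightarrow> 'a set) \<Rightarrow> bool" where
  "colored_complex n a \<Delta> V \<longleftrightarrow>
     simplicial_complex \<Delta> \<and> ordered_partition n V (vertices \<Delta>) \<and>
     (\<forall>F\<in>\<Delta>. \<forall>i\<in>{1..n}. card (F \<inter> V i) \<le> a i)"

definition balanced_complex ::
  "nat \<Rightarrow> (nat \<Rightarrow> nat) \<Rightarrow> 'a set set \<Rightarrow> (nat \<Rightarrow> 'a set) \<Rightarrow> bool" where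
  "balanced_complex n a \<Delta> V \<longleftrightarrow>
     colored_complex n a \<Delta> V \<and> complex_dim \<Delta> = int (\<Sum>i=1..n. a i) - 1"

text \<open>\<open>r i\<close> is the (reflexive) linear order on the colour class \<open>V i\<close>.\<close>

definition color_shifted ::
  "nat \<Rightarrow> (nat \<Rightarrow> 'a set) \<Rightarrow> (nat \<Rightarrow> 'a rel) \<Rightarrow> 'a set set \<Rightarrow> bool" where
  "color_shifted n V r \<Delta> \<longleftrightarrow>
     (\<forall>F\<in>\<Delta>. \<forall>i\<in>{1..n}. \<forall>v\<in>V i. \<forall>v'\<in>V i.
        (v', v) \<in> r i \<and> v' \<noteq> v \<and> v \<in> F \<and> v' \<notin> F \<longrightarrow> (F - {v}) \<union> {v'} \<in> \<Delta>)"

definition rib_generators ::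
  "nat \<Rightarrow> (nat \<Rightarrow> nat) \<Rightarrow> (nat \<Rightarrow> 'a set) \<Rightarrow> 'a set set \<Rightarrow> 'a set set" where
  "rib_generators n a V \<Delta> =
     {(\<Union>i\<in>{1..n}. F i) | F.
        (\<Union>i\<in>{1..n}. F i) \<in> \<Delta> \<and> (\<forall>i\<in>{1..n}. F i \<subseteq> V i \<and> card (F i) = a i)}"

definition rib_of :: "nat \<Rightarrow> (nat \<Rightarrow> nat) \<Rightarrow> 'a set set \<Rightarrow> 'a set set \<Rightarrow> bool" where
  "rib_of n a \<Gamma> \<Delta> \<longleftrightarrow>
     (\<exists>V. ordered_partition n V (vertices \<Delta>) \<and> rib_generators n a V \<Delta> \<noteq> {} \<and>
          \<Gamma> = generated_complex (rib_generators n a V \<Delta>))"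

text \<open>
  In the first rule the simplex may have vertices that are not vertices of its rib \<open>\<Delta>\<close>:
  this happens exactly when some entry of \<open>a\<close> is \<open>0\<close>. For instance \<open>{{}}\<close> is the rib, for
  the zero vector, of any simplex with at least \<open>n\<close> vertices.
\<close>

inductive macaulay_decomposable :: "nat \<Rightarrow> (nat \<Rightarrow> nat) \<Rightarrow> 'a set set \<Rightarrow> bool"
  for n :: nat where
  rib: "macaulay_decomposable n a \<Delta>"
    if "simplex S" "rib_of n a \<Delta> S"
| shed: "macaulay_decomposable n a \<Delta>"
    if "simplicial_complex \<Delta>" "x \<in> vertices \<Delta>" "vec_less n a' a"
      "macaulay_decomposable n a (deletion \<Delta> x)"
      "macaulay_decomposable n a' (link \<Delta> x)"
      "\<not> (\<exists>F. facet F (link \<Delta> x) \<and> facet F (deletion \<Delta> x))"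

end

theory Submission
  imports Defs
begin

text \<open>
  Shed the largest vertex \<open>x\<close> of a colour class \<open>V\<^sub>j\<close>. If \<open>V\<^sub>j\<close> contains more than \<open>a\<^sub>j\<close>
  vertices of the complex, then a facet through \<open>x\<close> misses some smaller vertex of \<open>V\<^sub>j\<close>, and
  colour-shiftedness exchanges \<open>x\<close> for it. Hence every face of the deletion lies in a facet
  that avoids \<open>x\<close>, so the deletion is again pure of type \<open>a\<close>. The link is pure of type
  \<open>a - e\<^sub>j\<close>, and both stay colour-shifted. A face shared as a facet by link and
  deletion would have type \<open>a\<close>, and adding \<open>x\<close> would give a face with too many vertices
  in \<open>V\<^sub>j\<close>. So \<open>x\<close> is a Macaulay shedding vertex, and induction on the
  number of vertices applies (\<open>type_pure_color_shifted_decomposable\<close>). The process stops when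
  each \<open>V\<^sub>j\<close> with \<open>a\<^sub>j > 0\<close> contains exactly \<open>a\<^sub>j\<close> vertices; the complex is then a simplex,
  which is a rib (\<open>type_pure_exhausted_decomposable\<close>).

  Passing to links lowers the entries of \<open>a\<close> and can remove all vertices of a colour, so the
  induction leaves the class of balanced complexes with positive \<open>a\<close>. It runs instead over
  complexes whose faces all extend to faces of type \<open>a\<close> with respect to a family \<open>V\<close> of
  disjoint sets that is kept fixed, and whose members may contain points that
  are not vertices of the complex. Such points are also what fills the parts with \<open>a\<^sub>i = 0\<close>
  of the partition that exhibits the final simplex as a rib.
\<close>

section \<open>Faces and types\<close>

definition type_pure ::
  "nat \<Rightarrow> (nat \<Rightarrow> nat) \<Rightarrow> (nat \<Rightarrow> 'a set) \<Rightarrow> 'a set set \<Rightarrow> bool" where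
  "type_pure n a V \<Delta> \<longleftrightarrow>
     simplicial_complex \<Delta> \<and> \<Delta> \<noteq> {} \<and> vertices \<Delta> \<subseteq> (\<Union>i\<in>{1..n}. V i) \<and>
     (\<forall>F\<in>\<Delta>. \<exists>G\<in>\<Delta>. F \<subseteq> G \<and> (\<forall>i\<in>{1..n}. card (G \<inter> V i) = a i))"

lemma simplicial_complex_subface:
  "simplicial_complex \<Delta> \<Longrightarrow> F \<in> \<Delta> \<Longrightarrow> G \<subseteq> F \<Longrightarrow> G \<in> \<Delta>"
  unfolding simplicial_complex_def by blast

lemma face_subset_vertices: "F \<in> \<Delta> \<Longrightarrow> F \<subseteq> vertices \<Delta>"
  unfolding vertices_def by blast

lemma finite_face: "simplicial_complex \<Delta> \<Longrightarrow> F \<in> \<Delta> \<Longrightarrow> finite F"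
  unfolding simplicial_complex_def by (meson face_subset_vertices finite_subset)

lemma finite_complex: "simplicial_complex \<Delta> \<Longrightarrow> finite \<Delta>"
  unfolding simplicial_complex_def vertices_def by (simp add: finite_UnionD)

lemma simplicial_complex_deletion:
  "simplicial_complex \<Delta> \<Longrightarrow> simplicial_complex (deletion \<Delta> x)"
  unfolding simplicial_complex_def deletion_def vertices_def
  by (auto intro: finite_subset[of _ "\<Union>\<Delta>"])

lemma simplicial_complex_link:
  assumes "simplicial_complex \<Delta>"
  shows "simplicial_complex (link \<Delta> x)"
  unfolding simplicial_complex_def
proof (intro conjI ballI allI impI)
  show "finite (vertices (link \<Delta> x))"
    using assms unfolding simplicial_complex_def vertices_def link_def
    by (auto intro: finite_subset[of _ "\<Union>\<Delta>"])
  fix F G assume "F \<in> link \<Delta> x" "G \<subseteq> F"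
  then show "G \<in> link \<Delta> x"
    using simplicial_complex_subface[OF assms, of F G]
      simplicial_complex_subface[OF assms, of "F \<union> {x}" "G \<union> {x}"]
    unfolding link_def by auto
qed

lemma vertices_deletion_subset: "vertices (deletion \<Delta> x) \<subseteq> vertices \<Delta> - {x}"
  unfolding vertices_def deletion_def by blast

lemma vertices_link_subset: "vertices (link \<Delta> x) \<subseteq> vertices \<Delta> - {x}"
  unfolding vertices_def link_def by blast

lemma type_pure_card_le:
  assumes "type_pure n a V \<Delta>" "F \<in> \<Delta>" "i \<in> {1..n}"
  shows "card (F \<inter> V i) \<le> a i"
proof -
  obtain G where G: "G \<in> \<Delta>" "F \<subseteq> G" "card (G \<inter> V i) = a i"
    using assms unfolding type_pure_def by blast
  have "finite G"
    using assms(1) G(1) finite_face unfolding type_pure_def by blast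
  then have "card (F \<inter> V i) \<le> card (G \<inter> V i)"
    using G(2) by (intro card_mono) auto
  then show ?thesis using G(3) by simp
qed

lemma linear_order_on_finite_has_greatest:
  assumes "linear_order_on A r" "finite B" "B \<noteq> {}" "B \<subseteq> A"
  shows "\<exists>x\<in>B. \<forall>y\<in>B. (y, x) \<in> r"
  using assms(2,3,4)
proof (induction B rule: finite_ne_induct)
  case (singleton x)
  then show ?case
    using assms(1) unfolding order_on_defs refl_on_def by auto
next
  case (insert z B)
  then obtain x where x: "x \<in> B" "\<forall>y\<in>B. (y, x) \<in> r" by auto
  have "trans r" "refl_on A r" "total_on A r"
    using assms(1) unfolding order_on_defs by blast+
  moreover have "z \<in> A" "x \<in> A" "z \<noteq> x" using insert.prems insert.hyps x(1) by auto
  ultimately have "(z, z) \<in> r" "(z, x) \<in> r \<or> (x, z) \<in> r"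
    by (simp_all add: refl_onD total_on_def)
  from this(2) consider "(z, x) \<in> r" | "(x, z) \<in> r" by blast
  then show ?case
  proof cases
    case 1
    then show ?thesis using x by auto
  next
    case 2
    then have "\<forall>y\<in>B. (y, z) \<in> r" using x(2) transD[OF \<open>trans r\<close>] by blast
    then show ?thesis using \<open>(z, z) \<in> r\<close> by auto
  qed
qed

section \<open>Shedding the largest vertex of a colour\<close>

text \<open>An exchange inside one colour class preserves the type of a face.\<close>

lemma exchange_card:
  assumes disj: "disjoint_family_on V I" and ij: "i \<in> I" "j \<in> I"
    and x: "x \<in> V j" "x \<in> G" and v: "v \<in> V j" "v \<notin> G" and fin: "finite G"
  shows "card ((G - {x} \<union> {v}) \<inter> V i) = card (G \<inter> V i)"
proof (cases "i = j")
  case True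
  have "(G - {x} \<union> {v}) \<inter> V i = insert v (G \<inter> V i - {x})"
    using True v by auto
  moreover have "x \<in> G \<inter> V i" using True x by simp
  ultimately show ?thesis
    using v fin card_Suc_Diff1[of "G \<inter> V i" x] by simp
next
  case False
  then have "x \<notin> V i" "v \<notin> V i"
    using disj ij x(1) v(1) unfolding disjoint_family_on_def by blast+
  then have "(G - {x} \<union> {v}) \<inter> V i = G \<inter> V i" by auto
  then show ?thesis by simp
qed

text \<open>
  A facet \<open>G\<close> through \<open>x\<close> has only \<open>a\<^sub>j\<close> of the more than \<open>a\<^sub>j\<close> vertices in \<open>V\<^sub>j\<close>. Trading
  \<open>x\<close> for one of the others, necessarily smaller, gives a face of the same type that avoids
  \<open>x\<close> and still contains every face below \<open>G\<close> that avoids \<open>x\<close>.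
\<close>

lemma type_pure_deletion:
  assumes pure: "type_pure n a V \<Delta>" and shifted: "color_shifted n V r \<Delta>"
    and disj: "disjoint_family_on V {1..n}"
    and j: "j \<in> {1..n}" and x: "x \<in> V j"
    and greatest: "\<forall>v\<in>V j \<inter> vertices \<Delta>. (v, x) \<in> r j"
    and many: "a j < card (V j \<inter> vertices \<Delta>)"
  shows "type_pure n a V (deletion \<Delta> x)"
proof -
  have cplx: "simplicial_complex \<Delta>" and ne: "\<Delta> \<noteq> {}"
    using pure unfolding type_pure_def by auto
  have "{} \<in> deletion \<Delta> x"
    using ne simplicial_complex_subface[OF cplx] unfolding deletion_def by blast
  moreover have "vertices (deletion \<Delta> x) \<subseteq> (\<Union>i\<in>{1..n}. V i)"
    using vertices_deletion_subset[of \<Delta> x] pure unfolding type_pure_def by blast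
  moreover have "\<exists>G\<in>deletion \<Delta> x. F \<subseteq> G \<and> (\<forall>i\<in>{1..n}. card (G \<inter> V i) = a i)"
    if F: "F \<in> deletion \<Delta> x" for F
  proof -
    have "F \<in> \<Delta>" "x \<notin> F" using F unfolding deletion_def by auto
    then obtain G where G: "G \<in> \<Delta>" "F \<subseteq> G" "\<forall>i\<in>{1..n}. card (G \<inter> V i) = a i"
      using pure unfolding type_pure_def by blast
    show ?thesis
    proof (cases "x \<in> G")
      case False
      then show ?thesis using G unfolding deletion_def by blast
    next
      case True
      have finG: "finite G" using finite_face[OF cplx G(1)] .
      have "\<not> V j \<inter> vertices \<Delta> \<subseteq> G \<inter> V j"
        using many G(3) j finG card_mono[of "G \<inter> V j" "V j \<inter> vertices \<Delta>"] by auto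
      then obtain v where v: "v \<in> V j" "v \<in> vertices \<Delta>" "v \<notin> G" by blast
      let ?G = "G - {x} \<union> {v}"
      have "?G \<in> \<Delta>"
        using shifted G(1) j x v True greatest unfolding color_shifted_def by blast
      moreover have "x \<notin> ?G" using v(3) True by auto
      moreover have "F \<subseteq> ?G" using G(2) \<open>x \<notin> F\<close> by blast
      moreover have "\<forall>i\<in>{1..n}. card (?G \<inter> V i) = a i"
        using exchange_card[OF disj _ j x True v(1,3) finG] G(3) by simp
      ultimately show ?thesis unfolding deletion_def by blast
    qed
  qed
  ultimately show ?thesis
    using simplicial_complex_deletion[OF cplx] unfolding type_pure_def by blast
qed

text \<open>
  Only the largest vertex can be deleted safely: shifting a face that contains a larger vertex
  of \<open>V\<^sub>j\<close> could bring \<open>x\<close> back.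
\<close>

lemma color_shifted_deletion:
  assumes shifted: "color_shifted n V r \<Delta>"
    and disj: "disjoint_family_on V {1..n}"
    and j: "j \<in> {1..n}" and x: "x \<in> V j" and anti: "antisym (r j)"
    and greatest: "\<forall>v\<in>V j \<inter> vertices \<Delta>. (v, x) \<in> r j"
  shows "color_shifted n V r (deletion \<Delta> x)"
  unfolding color_shifted_def
proof (intro ballI impI)
  fix F i v v'
  assume F: "F \<in> deletion \<Delta> x" and i: "i \<in> {1..n}" and v: "v \<in> V i" "v' \<in> V i"
    and *: "(v', v) \<in> r i \<and> v' \<noteq> v \<and> v \<in> F \<and> v' \<notin> F"
  have F': "F \<in> \<Delta>" "x \<notin> F" using F unfolding deletion_def by auto
  have "F - {v} \<union> {v'} \<in> \<Delta>"
    using shifted F' i v * unfolding color_shifted_def by blast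
  moreover have "v' \<noteq> x"
  proof
    assume "v' = x"
    then have "i = j"
      using disj i j v x unfolding disjoint_family_on_def by blast
    have "v \<in> vertices \<Delta>" using face_subset_vertices[OF F'(1)] * by blast
    then have "(v, x) \<in> r j" "(x, v) \<in> r j"
      using greatest v(1) * \<open>v' = x\<close> \<open>i = j\<close> by simp_all
    then have "v = x" by (rule antisymD[OF anti])
    then show False using * \<open>v' = x\<close> by simp
  qed
  ultimately show "F - {v} \<union> {v'} \<in> deletion \<Delta> x"
    using F' unfolding deletion_def by blast
qed

text \<open>
  The facets of the link are the facets through \<open>x\<close> with \<open>x\<close> removed. Since \<open>x\<close> is itself a
  vertex in \<open>V\<^sub>j\<close>, \<open>a\<^sub>j\<close> is positive and the subtraction is not truncated.
\<close>

lemma type_pure_link: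
  assumes pure: "type_pure n a V \<Delta>"
    and disj: "disjoint_family_on V {1..n}"
    and j: "j \<in> {1..n}" and x: "x \<in> V j" "x \<in> vertices \<Delta>"
  shows "type_pure n (a(j := a j - 1)) V (link \<Delta> x)"
proof -
  have cplx: "simplicial_complex \<Delta>"
    using pure unfolding type_pure_def by auto
  obtain E where E: "E \<in> \<Delta>" "x \<in> E" using x(2) unfolding vertices_def by blast
  have "{} \<in> link \<Delta> x"
    using E(2) simplicial_complex_subface[OF cplx E(1)] unfolding link_def by simp
  moreover have "vertices (link \<Delta> x) \<subseteq> (\<Union>i\<in>{1..n}. V i)"
    using vertices_link_subset[of \<Delta> x] pure unfolding type_pure_def by blast
  moreover have "\<exists>G\<in>link \<Delta> x. F \<subseteq> G \<and> (\<forall>i\<in>{1..n}. card (G \<inter> V i) = (a(j := a j - 1)) i)"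
    if F: "F \<in> link \<Delta> x" for F
  proof -
    have "F \<union> {x} \<in> \<Delta>" "x \<notin> F" using F unfolding link_def by auto
    then obtain G where G: "G \<in> \<Delta>" "F \<union> {x} \<subseteq> G" "\<forall>i\<in>{1..n}. card (G \<inter> V i) = a i"
      using pure unfolding type_pure_def by blast
    have "G - {x} \<union> {x} = G" using G(2) by blast
    then have "G - {x} \<in> link \<Delta> x"
      using G(1) simplicial_complex_subface[OF cplx G(1), of "G - {x}"]
      unfolding link_def by auto
    moreover have "F \<subseteq> G - {x}" using G(2) \<open>x \<notin> F\<close> by blast
    moreover have "card ((G - {x}) \<inter> V i) = (a(j := a j - 1)) i" if i: "i \<in> {1..n}" for i
    proof (cases "i = j")
      case True
      have "(G - {x}) \<inter> V i = (G \<inter> V i) - {x}" by blast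
      then show ?thesis using True G i x by simp
    next
      case False
      then have "x \<notin> V i"
        using disj i j x(1) unfolding disjoint_family_on_def by blast
      then have "(G - {x}) \<inter> V i = G \<inter> V i" by blast
      then show ?thesis using False G i by simp
    qed
    ultimately show ?thesis by blast
  qed
  ultimately show ?thesis
    using simplicial_complex_link[OF cplx] unfolding type_pure_def by blast
qed

lemma color_shifted_link:
  assumes cplx: "simplicial_complex \<Delta>" and shifted: "color_shifted n V r \<Delta>"
    and disj: "disjoint_family_on V {1..n}"
    and j: "j \<in> {1..n}" and x: "x \<in> V j" and anti: "antisym (r j)"
    and greatest: "\<forall>v\<in>V j \<inter> vertices \<Delta>. (v, x) \<in> r j"
  shows "color_shifted n V r (link \<Delta> x)"
  unfolding color_shifted_def
proof (intro ballI impI)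
  fix F i v v'
  assume F: "F \<in> link \<Delta> x" and i: "i \<in> {1..n}" and v: "v \<in> V i" "v' \<in> V i"
    and *: "(v', v) \<in> r i \<and> v' \<noteq> v \<and> v \<in> F \<and> v' \<notin> F"
  have F': "F \<in> deletion \<Delta> x" "F \<union> {x} \<in> \<Delta>" "x \<notin> F"
    using F unfolding link_def deletion_def by auto
  have del: "F - {v} \<union> {v'} \<in> deletion \<Delta> x"
    using color_shifted_deletion[OF shifted disj j x anti greatest] F' i v *
    unfolding color_shifted_def by blast
  have "v' \<notin> F \<union> {x}" "v \<noteq> x"
    using del * F'(3) unfolding deletion_def by auto
  then have "(F \<union> {x}) - {v} \<union> {v'} \<in> \<Delta>"
    using shifted F'(2) i v * unfolding color_shifted_def by blast
  moreover have "(F \<union> {x}) - {v} \<union> {v'} = (F - {v} \<union> {v'}) \<union> {x}"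
    using \<open>v \<noteq> x\<close> by blast
  ultimately show "F - {v} \<union> {v'} \<in> link \<Delta> x"
    using del unfolding link_def deletion_def by simp
qed

text \<open>
  A common facet \<open>F\<close> would have type \<open>a\<close>, because it is a facet of the deletion, while
  \<open>F \<union> {x}\<close> is still a face of \<open>\<Delta>\<close>.
\<close>

lemma no_common_facet:
  assumes pure: "type_pure n a V \<Delta>" and pure_del: "type_pure n a V (deletion \<Delta> x)"
    and j: "j \<in> {1..n}" and x: "x \<in> V j"
  shows "\<not> (\<exists>F. facet F (link \<Delta> x) \<and> facet F (deletion \<Delta> x))"
proof
  assume "\<exists>F. facet F (link \<Delta> x) \<and> facet F (deletion \<Delta> x)"
  then obtain F where F: "F \<in> link \<Delta> x" "facet F (deletion \<Delta> x)"
    unfolding facet_def by blast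
  then have "card (F \<inter> V j) = a j"
    using pure_del j unfolding type_pure_def facet_def by blast
  moreover have F': "F \<in> \<Delta>" "F \<union> {x} \<in> \<Delta>" "x \<notin> F"
    using F(1) unfolding link_def by auto
  moreover have "finite F"
    using pure F'(1) finite_face unfolding type_pure_def by blast
  moreover have "(F \<union> {x}) \<inter> V j = insert x (F \<inter> V j)" using x by blast
  ultimately have "card ((F \<union> {x}) \<inter> V j) = Suc (a j)" by simp
  then show False using type_pure_card_le[OF pure F'(2) j] by simp
qed

section \<open>Complexes without spare vertices\<close>

text \<open>
  When no colour has a vertex to spare, the facets contain all vertices of \<open>\<Delta>\<close>, so \<open>\<Delta>\<close> is the
  simplex on its vertex set. To see it as a rib of type \<open>a\<close>, the colours with \<open>a\<^sub>i = 0\<close> need a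
  non-empty part as well; a single point of \<open>V\<^sub>i\<close> serves, and it does not enter the rib.
\<close>

lemma type_pure_exhausted_decomposable:
  assumes pure: "type_pure n a V \<Delta>"
    and disj: "disjoint_family_on V {1..n}" and ne: "\<forall>i\<in>{1..n}. V i \<noteq> {}"
    and few: "\<forall>i\<in>{1..n}. card (V i \<inter> vertices \<Delta>) \<le> a i"
  shows "macaulay_decomposable n a \<Delta>"
proof -
  have cplx: "simplicial_complex \<Delta>" and fin: "finite (vertices \<Delta>)"
    and vert: "vertices \<Delta> \<subseteq> (\<Union>i\<in>{1..n}. V i)"
    using pure unfolding type_pure_def simplicial_complex_def by auto
  obtain G where G: "G \<in> \<Delta>" "\<forall>i\<in>{1..n}. card (G \<inter> V i) = a i"
    using pure unfolding type_pure_def by blast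
  have sub: "G \<inter> V i \<subseteq> V i \<inter> vertices \<Delta>" for i
    using face_subset_vertices[OF G(1)] by blast
  have G_eq: "G \<inter> V i = V i \<inter> vertices \<Delta>" if "i \<in> {1..n}" for i
    using card_seteq[OF _ sub] fin few G(2) that by simp
  have G_vertices: "G = vertices \<Delta>"
    using G_eq vert face_subset_vertices[OF G(1)] by blast
  have G_card: "card (V i \<inter> G) = a i" if "i \<in> {1..n}" for i
    using G(2) that by (simp add: Int_commute)
  have \<Delta>_eq: "\<Delta> = {H. H \<subseteq> G}"
    using simplicial_complex_subface[OF cplx G(1)] face_subset_vertices[of _ \<Delta>]
    unfolding G_vertices by blast
  obtain w where w: "\<forall>i\<in>{1..n}. w i \<in> V i"
    using bchoice[of "{1..n}" "\<lambda>i x. x \<in> V i"] ne by blast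
  define U where "U i = (if a i = 0 then {w i} else V i \<inter> G)" for i
  define W where "W = (\<Union>i\<in>{1..n}. U i)"
  define S where "S = generated_complex {W}"
  have finG: "finite G" using fin G_vertices by simp
  have finU: "finite (U i)" for i using finG unfolding U_def by simp
  then have finW: "finite W" unfolding W_def by simp
  have U_sub: "U i \<subseteq> V i" if "i \<in> {1..n}" for i
    using w that unfolding U_def by auto
  have S_eq: "S = {H. H \<subseteq> W}"
    unfolding S_def using finW by (subst generated_complex_eq) auto
  have part: "ordered_partition n U (vertices S)"
  proof -
    have "U i \<noteq> {}" if "i \<in> {1..n}" for i
      using G_card[OF that] unfolding U_def by auto
    moreover have "disjoint_family_on U {1..n}"
      using disj U_sub unfolding disjoint_family_on_def by blast
    moreover have "vertices S = W" unfolding S_eq vertices_def by blast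
    ultimately show ?thesis unfolding ordered_partition_def W_def by blast
  qed
  (* If a i = 0 the part {w i} is bigger than V i \<inter> G, but it contributes no vertex to a generator;
     otherwise the part has exactly a i elements and contributes all of them. *)
  have forced: "H = V i \<inter> G" if i: "i \<in> {1..n}" and "H \<subseteq> U i" "card H = a i" for H i
  proof (cases "a i = 0")
    case True
    have "finite H" using finU that finite_subset by blast
    moreover have "V i \<inter> G = {}" using G_card[OF i] True finG by simp
    ultimately show ?thesis using True that by simp
  next
    case False
    then show ?thesis
      using card_seteq[of "V i \<inter> G" H] finG G_card[OF i] that unfolding U_def by simp
  qed
  have G_union: "(\<Union>i\<in>{1..n}. V i \<inter> G) = G" using vert G_vertices by blast
  have G_in: "V i \<inter> G \<subseteq> U i" if i: "i \<in> {1..n}" for i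
    using G_card[OF i] finG unfolding U_def by auto
  have "rib_generators n a U S = {G}"
  proof
    show "rib_generators n a U S \<subseteq> {G}"
    proof
      fix H assume "H \<in> rib_generators n a U S"
      then obtain F where "H = (\<Union>i\<in>{1..n}. F i)"
        and F: "\<forall>i\<in>{1..n}. F i \<subseteq> U i \<and> card (F i) = a i"
        unfolding rib_generators_def by blast
      moreover have "(\<Union>i\<in>{1..n}. F i) = (\<Union>i\<in>{1..n}. V i \<inter> G)"
        using F forced by (intro SUP_cong refl) blast
      ultimately show "H \<in> {G}" using G_union by simp
    qed
    have "(\<Union>i\<in>{1..n}. V i \<inter> G) \<in> S" using G_in unfolding S_eq W_def by blast
    then have "(\<Union>i\<in>{1..n}. V i \<inter> G) \<in> rib_generators n a U S"
      using G_in G_card unfolding rib_generators_def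
      by (intro CollectI exI[of _ "\<lambda>i. V i \<inter> G"] conjI refl) auto
    then show "{G} \<subseteq> rib_generators n a U S" using G_union by simp
  qed
  moreover have "\<Delta> = generated_complex {G}"
    using finG \<Delta>_eq by (subst generated_complex_eq) auto
  ultimately have "rib_of n a \<Delta> S" using part unfolding rib_of_def by auto
  moreover have "simplex S" using finW unfolding simplex_def S_def by blast
  ultimately show ?thesis by (rule macaulay_decomposable.rib[rotated])
qed

section \<open>Decomposing pure color-shifted complexes\<close>

theorem type_pure_color_shifted_decomposable:
  assumes disj: "disjoint_family_on V {1..n}" and ne: "\<forall>i\<in>{1..n}. V i \<noteq> {}"
    and lin: "\<forall>i\<in>{1..n}. linear_order_on (V i) (r i)"
    and "type_pure n a V \<Delta>" "color_shifted n V r \<Delta>"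
  shows "macaulay_decomposable n a \<Delta>"
  using assms(4,5)
proof (induction "card (vertices \<Delta>)" arbitrary: a \<Delta> rule: less_induct)
  case less
  note pure = less.prems(1) and shifted = less.prems(2)
  have cplx: "simplicial_complex \<Delta>" and fin: "finite (vertices \<Delta>)"
    using pure unfolding type_pure_def simplicial_complex_def by auto
  show ?case
  proof (cases "\<forall>i\<in>{1..n}. card (V i \<inter> vertices \<Delta>) \<le> a i")
    case True
    then show ?thesis using type_pure_exhausted_decomposable[OF pure disj ne] by blast
  next
    case False
    then obtain j where j: "j \<in> {1..n}" and many: "a j < card (V j \<inter> vertices \<Delta>)"
      by (auto simp: not_le)
    have "V j \<inter> vertices \<Delta> \<noteq> {}" using many by auto
    then obtain x where "x \<in> V j \<inter> vertices \<Delta>"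
      and greatest: "\<forall>v\<in>V j \<inter> vertices \<Delta>. (v, x) \<in> r j"
      using linear_order_on_finite_has_greatest[of "V j" "r j" "V j \<inter> vertices \<Delta>"] lin j fin
      by blast
    then have x: "x \<in> V j" "x \<in> vertices \<Delta>" by auto
    have anti: "antisym (r j)" using lin j unfolding order_on_defs by blast
    let ?a' = "a(j := a j - 1)"
    have "{x} \<in> \<Delta>"
      using x(2) simplicial_complex_subface[OF cplx] unfolding vertices_def by blast
    then have "card ({x} \<inter> V j) \<le> a j" using type_pure_card_le[OF pure _ j] by blast
    then have "a j \<ge> 1" using x(1) by simp
    then have "vec_less n ?a' a" using j unfolding vec_less_def by auto
    have smaller: "card B < card (vertices \<Delta>)" if "B \<subseteq> vertices \<Delta> - {x}" for B
      using that x(2) fin by (intro psubset_card_mono) auto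
    note pure_del = type_pure_deletion[OF pure shifted disj j x(1) greatest many]
    show ?thesis
    proof (rule macaulay_decomposable.shed[OF cplx x(2) \<open>vec_less n ?a' a\<close>])
      show "macaulay_decomposable n a (deletion \<Delta> x)"
        using less.hyps[OF smaller[OF vertices_deletion_subset] pure_del]
          color_shifted_deletion[OF shifted disj j x(1) anti greatest] .
      show "macaulay_decomposable n ?a' (link \<Delta> x)"
        using less.hyps[OF smaller[OF vertices_link_subset] type_pure_link[OF pure disj j x]]
          color_shifted_link[OF cplx shifted disj j x(1) anti greatest] .
      show "\<not> (\<exists>F. facet F (link \<Delta> x) \<and> facet F (deletion \<Delta> x))"
        by (rule no_common_facet[OF pure pure_del j x(1)])
    qed
  qed
qed

lemma face_in_facet:
  assumes "simplicial_complex \<Delta>" "F \<in> \<Delta>"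
  obtains G where "facet G \<Delta>" "F \<subseteq> G"
  using finite_has_maximal2[OF finite_complex[OF assms(1)] assms(2)]
  unfolding facet_def by metis

text \<open>
  Purity makes every facet as large as the largest one, which has \<open>|a|\<close> elements; since no
  colour class contributes more than \<open>a\<^sub>i\<close>, each contributes exactly \<open>a\<^sub>i\<close>.
\<close>

lemma pure_balanced_type_pure:
  assumes bal: "balanced_complex n a \<Delta> V" and pure: "pure_complex \<Delta>" and "\<Delta> \<noteq> {}"
  shows "type_pure n a V \<Delta>"
proof -
  have cplx: "simplicial_complex \<Delta>" and part: "ordered_partition n V (vertices \<Delta>)"
    and le: "\<And>F i. F \<in> \<Delta> \<Longrightarrow> i \<in> {1..n} \<Longrightarrow> card (F \<inter> V i) \<le> a i"
    and dim: "complex_dim \<Delta> = int (\<Sum>i=1..n. a i) - 1"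
    using bal unfolding balanced_complex_def colored_complex_def by auto
  have disj: "disjoint_family_on V {1..n}" and Un: "(\<Union>i\<in>{1..n}. V i) = vertices \<Delta>"
    using part unfolding ordered_partition_def by auto
  have "complex_dim \<Delta> \<in> face_dim ` \<Delta>"
    unfolding complex_dim_def using finite_complex[OF cplx] \<open>\<Delta> \<noteq> {}\<close> by (intro Max_in) auto
  then obtain M where M: "M \<in> \<Delta>" "face_dim M = complex_dim \<Delta>" by auto
  have M_card: "card M = (\<Sum>i=1..n. a i)"
    using M(2) dim unfolding face_dim_def by linarith
  obtain M' where M': "facet M' \<Delta>" "M \<subseteq> M'" using face_in_facet[OF cplx M(1)] .
  have "card (G \<inter> V i) = a i" if G: "facet G \<Delta>" and i: "i \<in> {1..n}" for G i
  proof -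
    have G': "G \<in> \<Delta>" "finite G" "finite M'"
      using G M' finite_face[OF cplx] unfolding facet_def by auto
    have "face_dim M' = face_dim G"
      using pure G M'(1) unfolding pure_complex_def by blast
    then have M'_card: "card M' = card G" unfolding face_dim_def by simp
    have "G = (\<Union>i\<in>{1..n}. G \<inter> V i)"
      using face_subset_vertices[OF G'(1)] Un by blast
    then have "card G = card (\<Union>i\<in>{1..n}. G \<inter> V i)" by (rule arg_cong)
    also have "\<dots> = (\<Sum>i=1..n. card (G \<inter> V i))"
      using disj G'(2) unfolding disjoint_family_on_def
      by (intro card_UN_disjoint) auto
    finally have G_card: "card G = (\<Sum>i=1..n. card (G \<inter> V i))" .
    have "card M \<le> card M'" using M' G' by (intro card_mono)
    then have "(\<Sum>i=1..n. a i) \<le> (\<Sum>i=1..n. card (G \<inter> V i))"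
      using M_card M'_card G_card by simp
    then have "(\<Sum>i=1..n. card (G \<inter> V i)) = (\<Sum>i=1..n. a i)"
      using sum_mono[of "{1..n}" "\<lambda>i. card (G \<inter> V i)" a] le[OF G'(1)]
      by (intro antisym) auto
    then show ?thesis
      using sum_mono_inv[of "\<lambda>i. card (G \<inter> V i)" "{1..n}" a i] le[OF G'(1)] i by auto
  qed
  then have "\<exists>G\<in>\<Delta>. F \<subseteq> G \<and> (\<forall>i\<in>{1..n}. card (G \<inter> V i) = a i)" if "F \<in> \<Delta>" for F
    using face_in_facet[OF cplx that] unfolding facet_def by metis
  then show ?thesis
    using cplx \<open>\<Delta> \<noteq> {}\<close> Un unfolding type_pure_def by blast
qed

theorem theorem4p12:
  fixes n :: nat
    and a :: "nat \<Rightarrow> nat"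
    and \<Delta> :: "'a set set"
    and V :: "nat \<Rightarrow> 'a set"
    and r :: "nat \<Rightarrow> 'a rel"
  assumes "n \<ge> 1"
    and "\<forall>i\<in>{1..n}. a i \<ge> 1"
    and "balanced_complex n a \<Delta> V"
    and "pure_complex \<Delta>"
    and "\<forall>i\<in>{1..n}. linear_order_on (V i) (r i)"
    and "color_shifted n V r \<Delta>"
  shows "macaulay_decomposable n a \<Delta>"
proof -
  have part: "ordered_partition n V (vertices \<Delta>)"
    using assms(3) unfolding balanced_complex_def colored_complex_def by blast
  then have disj: "disjoint_family_on V {1..n}" and ne: "\<forall>i\<in>{1..n}. V i \<noteq> {}"
    unfolding ordered_partition_def by auto
  have "V 1 \<noteq> {}" "V 1 \<subseteq> vertices \<Delta>"
    using part assms(1) unfolding ordered_partition_def by auto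
  then have "\<Delta> \<noteq> {}" unfolding vertices_def by auto
  then show ?thesis
    using type_pure_color_shifted_decomposable[OF disj ne assms(5)]
      pure_balanced_type_pure[OF assms(3,4)] assms(6) by blast
qed

end
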